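(* For every hypersequent $G$: if $G$ is derivable in the hypersequent calculus $\mathbf{HMR}$, then $[\![G]\!]\geq 0$ is derivable in equational logic from the axioms of modal Riesz spaces, i.e. $[\![G]\!]\geq0$ holds in every modal Riesz space under every assignment of the variables.
   Context: Modal Riesz spaces: a modal Riesz space is a Riesz space (vector lattice) $V$ with a distinguished element $1$ and a map $\Diamond:V\to V$ satisfying $0\leq 1$, $\Diamond(r_1a+r_2b)=r_1\Diamond a+r_2\Diamond b$, $\Diamond(0\sqcup a)\geq 0$ and $\Diamond(1)\leq 1$. Terms. Fix a countable set of variables $x,y,\dots$. Terms (in negation normal form) are generated by $A ::= x \mid \overline{x} \mid 0 \mid 1 \mid \overline{1} \mid A+A \mid rA \mid A\sqcup A \mid A\sqcap A \mid \Diamond A$ with $r\in\mathbb{R}_{>0}$; they are interpreted in modal Riesz spaces reading $\overline{x}$ as $-x$ and $\overline{1}$ as $-1$. Negation: $\overline{x}$ for $x$, $\overline{\overline{x}}=x$, $\overline{0}=0$, $\overline 1$ for $1$, $\overline{\overline{1}}=1$, $\overline{A+B}=\overline A+\overline B$, $\overline{rA}=r\overline A$, $\overline{A\sqcup B}=\overline A\sqcap\overline B$, $\overline{A\sqcap B}=\overline A\sqcup\overline B$, $\overline{\Diamond A}=\Diamond\overline A$. A weighted term is $r.A$ ($r>0$); a sequent $\vdash\Gamma$ has $\Gamma$ a finite (possibly empty) multiset of weighted terms; a hypersequent is a nonempty finite multiset of sequents $\vdash\Gamma_1\mid\cdots\mid\vdash\Gamma_n$; $G\mid\vdash\Gamma$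 adds a sequent. For a finite (possibly empty) sequence $\vec r=(r_1,\dots,r_n)$ of positive reals, $\vec r.A$ is the multiset $r_1.A,\dots,r_n.A$, $\sum\vec r=r_1+\dots+r_n$, $s\vec r=(sr_1,\dots,sr_n)$; $s.\Gamma$ multiplies all weights by $s>0$; if $\Gamma=r_1.A_1,\dots,r_n.A_n$ then $\Diamond\Gamma=r_1.\Diamond A_1,\dots,r_n.\Diamond A_n$. Interpretation: $[\![r.A]\!]=rA$, a sequent is the sum of its weighted terms (empty sum $0$), a hypersequent is the join of its sequents. The calculus $\mathbf{HMR}$ has the rules: INIT: $\vdash$ with no premises. W: from $G$ infer $G\mid\vdash\Gamma$. C: from $G\mid\vdash\Gamma\mid\vdash\Gamma$ infer $G\mid\vdash\Gamma$. S: from $G\mid\vdash\Gamma_1,\Gamma_2$ infer $G\mid\vdash\Gamma_1\mid\vdash\Gamma_2$. M: from $G\mid\vdash\Gamma_1$ and $G\mid\vdash\Gamma_2$ infer $G\mid\vdash\Gamma_1,\Gamma_2$. T: for $r>0$, from $G\mid\vdash r.\Gamma$ infer $G\mid\vdash\Gamma$. ID: if $\sum\vec r=\sum\vec s$, from $G\mid\vdash\Gamma$ infer $G\mid\vdash\Gamma,\vec r.x,\vec s.\overline{x}$ ($x$ a variable). 0: from $G\mid\vdash\Gamma$ infer $G\mid\vdash\Gamma,\vec r.0$. $+$: from $G\mid\vdash\Gamma,\vec r.A,\vec r.B$ infer $G\mid\vdash\Gamma,\vec r.(A+B)$. $\times$: from $G\mid\vdash\Gamma,(s\vec r).A$ infer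 $G\mid\vdash\Gamma,\vec r.(sA)$. $\sqcup$: from $G\mid\vdash\Gamma,\vec r.A\mid\vdash\Gamma,\vec r.B$ infer $G\mid\vdash\Gamma,\vec r.(A\sqcup B)$. $\sqcap$: from $G\mid\vdash\Gamma,\vec r.A$ and $G\mid\vdash\Gamma,\vec r.B$ infer $G\mid\vdash\Gamma,\vec r.(A\sqcap B)$. CAN: if $\sum\vec r=\sum\vec s$, from $G\mid\vdash\Gamma,\vec s.A,\vec r.\overline A$ infer $G\mid\vdash\Gamma$. 1: if $\sum\vec r\geq\sum\vec s$, from $G\mid\vdash\Gamma$ infer $G\mid\vdash\Gamma,\vec r.1,\vec s.\overline{1}$. $\Diamond$: if $\sum\vec r\geq\sum\vec s$, from the single-sequent hypersequent $\vdash\Gamma,\vec r.1,\vec s.\overline 1$ infer the single-sequent hypersequent $\vdash\Diamond\Gamma,\vec r.1,\vec s.\overline 1$. A derivation is a finite tree of rule instances whose leaves are INIT. *)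

theory Defs
  imports Complex_Main "HOL-Library.Multiset"
begin

text \<open>Modal Riesz spaces. The order of a Riesz space and its lattice operations are those of the type
  class; the element \<open>u\<close> is the distinguished constant written \<open>1\<close> in the signature.\<close>

class riesz_space = ordered_real_vector + lattice

locale modal_riesz_space =
  fixes u :: "'v::riesz_space" and dia :: "'v \<Rightarrow> 'v"
  assumes zero_le_unit: "0 \<le> u"
    and dia_linear: "dia (r1 *\<^sub>R a + r2 *\<^sub>R b) = r1 *\<^sub>R dia a + r2 *\<^sub>R dia b"
    and dia_positive: "0 \<le> dia (sup 0 a)"
    and dia_unit: "dia u \<le> u"

typedef preal = "{r::real. 0 < r}" morphisms real_of_preal Abs_preal
  by (auto intro: exI [of _ 1])

definition preal_mult :: "preal \<Rightarrow> preal \<Rightarrow> preal" (infixl \<open>*\<^sub>p\<close> 70)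
  where "r *\<^sub>p s = Abs_preal (real_of_preal r * real_of_preal s)"

text \<open>Terms in negation normal form; \<open>NVar x\<close> and \<open>NOne\<close> are the negated variable and the negated \<open>1\<close>.\<close>

datatype nterm =
    Var nat
  | NVar nat
  | Zero
  | One
  | NOne
  | Plus nterm nterm
  | Scale preal nterm
  | Join nterm nterm
  | Meet nterm nterm
  | Dia nterm

primrec neg :: "nterm \<Rightarrow> nterm" where
  "neg (Var x) = NVar x"
| "neg (NVar x) = Var x"
| "neg Zero = Zero"
| "neg One = NOne"
| "neg NOne = One"
| "neg (Plus A B) = Plus (neg A) (neg B)"
| "neg (Scale r A) = Scale r (neg A)"
| "neg (Join A B) = Meet (neg A) (neg B)"
| "neg (Meet A B) = Join (neg A) (neg B)"
| "neg (Dia A) = Dia (neg A)"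

text \<open>Being nonempty is not part of the type of hypersequents: it is an invariant of the calculus
  (\<open>HMR_nonempty\<close> below).\<close>

type_synonym sequent = "(preal \<times> nterm) multiset"
type_synonym hypersequent = "sequent multiset"

definition weighted :: "preal list \<Rightarrow> nterm \<Rightarrow> sequent" (infix \<open>\<^bold>.\<close> 80)
  where "rs \<^bold>. A = mset (map (\<lambda>r. (r, A)) rs)"

definition total :: "preal list \<Rightarrow> real"
  where "total rs = (\<Sum>r\<leftarrow>rs. real_of_preal r)"

definition scale_sequent :: "preal \<Rightarrow> sequent \<Rightarrow> sequent"
  where "scale_sequent s \<Gamma> = image_mset (\<lambda>(r, A). (s *\<^sub>p r, A)) \<Gamma>"

definition dia_sequent :: "sequent \<Rightarrow> sequent"
  where "dia_sequent \<Gamma> = image_mset (\<lambda>(r, A). (r, Dia A)) \<Gamma>"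

text \<open>In a premise or conclusion \<open>G + {#\<Gamma>#}\<close> the context \<open>G\<close> may be empty.\<close>

inductive HMR :: "hypersequent \<Rightarrow> bool" where
  INIT: "HMR {#{#}#}"
| W: "HMR G \<Longrightarrow> HMR (G + {#\<Gamma>#})"
| C: "HMR (G + {#\<Gamma>#} + {#\<Gamma>#}) \<Longrightarrow> HMR (G + {#\<Gamma>#})"
| S: "HMR (G + {#\<Gamma>1 + \<Gamma>2#}) \<Longrightarrow> HMR (G + {#\<Gamma>1#} + {#\<Gamma>2#})"
| M: "HMR (G + {#\<Gamma>1#}) \<Longrightarrow> HMR (G + {#\<Gamma>2#}) \<Longrightarrow> HMR (G + {#\<Gamma>1 + \<Gamma>2#})"
| T: "HMR (G + {#scale_sequent r \<Gamma>#}) \<Longrightarrow> HMR (G + {#\<Gamma>#})"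
| ID: "total rs = total ss \<Longrightarrow> HMR (G + {#\<Gamma>#}) \<Longrightarrow>
    HMR (G + {#\<Gamma> + rs \<^bold>. Var x + ss \<^bold>. NVar x#})"
| ZERO: "HMR (G + {#\<Gamma>#}) \<Longrightarrow> HMR (G + {#\<Gamma> + rs \<^bold>. Zero#})"
| PLUS: "HMR (G + {#\<Gamma> + rs \<^bold>. A + rs \<^bold>. B#}) \<Longrightarrow> HMR (G + {#\<Gamma> + rs \<^bold>. Plus A B#})"
| TIMES: "HMR (G + {#\<Gamma> + map (\<lambda>r. s *\<^sub>p r) rs \<^bold>. A#}) \<Longrightarrow> HMR (G + {#\<Gamma> + rs \<^bold>. Scale s A#})"
| JOIN: "HMR (G + {#\<Gamma> + rs \<^bold>. A#} + {#\<Gamma> + rs \<^bold>. B#}) \<Longrightarrow> HMR (G + {#\<Gamma> + rs \<^bold>. Join A B#})"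
| MEET: "HMR (G + {#\<Gamma> + rs \<^bold>. A#}) \<Longrightarrow> HMR (G + {#\<Gamma> + rs \<^bold>. B#}) \<Longrightarrow>
    HMR (G + {#\<Gamma> + rs \<^bold>. Meet A B#})"
| CAN: "total rs = total ss \<Longrightarrow> HMR (G + {#\<Gamma> + ss \<^bold>. A + rs \<^bold>. neg A#}) \<Longrightarrow> HMR (G + {#\<Gamma>#})"
| ONE: "total rs \<ge> total ss \<Longrightarrow> HMR (G + {#\<Gamma>#}) \<Longrightarrow>
    HMR (G + {#\<Gamma> + rs \<^bold>. One + ss \<^bold>. NOne#})"
| DIA: "total rs \<ge> total ss \<Longrightarrow> HMR {#\<Gamma> + rs \<^bold>. One + ss \<^bold>. NOne#} \<Longrightarrow>
    HMR {#dia_sequent \<Gamma> + rs \<^bold>. One + ss \<^bold>. NOne#}"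

lemma HMR_nonempty: "HMR G \<Longrightarrow> G \<noteq> {#}"
  by (induction rule: HMR.induct) simp_all

text \<open>The value of terms, sequents and hypersequents in a modal Riesz space under an assignment \<open>\<rho>\<close>.
  Joins are idempotent, so the join of a hypersequent is taken over its underlying set.\<close>

primrec term_val :: "'v::riesz_space \<Rightarrow> ('v \<Rightarrow> 'v) \<Rightarrow> (nat \<Rightarrow> 'v) \<Rightarrow> nterm \<Rightarrow> 'v" where
  "term_val u dia \<rho> (Var x) = \<rho> x"
| "term_val u dia \<rho> (NVar x) = - \<rho> x"
| "term_val u dia \<rho> Zero = 0"
| "term_val u dia \<rho> One = u"
| "term_val u dia \<rho> NOne = - u"
| "term_val u dia \<rho> (Plus A B) = term_val u dia \<rho> A + term_val u dia \<rho> B"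
| "term_val u dia \<rho> (Scale r A) = real_of_preal r *\<^sub>R term_val u dia \<rho> A"
| "term_val u dia \<rho> (Join A B) = sup (term_val u dia \<rho> A) (term_val u dia \<rho> B)"
| "term_val u dia \<rho> (Meet A B) = inf (term_val u dia \<rho> A) (term_val u dia \<rho> B)"
| "term_val u dia \<rho> (Dia A) = dia (term_val u dia \<rho> A)"

definition sequent_val :: "'v::riesz_space \<Rightarrow> ('v \<Rightarrow> 'v) \<Rightarrow> (nat \<Rightarrow> 'v) \<Rightarrow> sequent \<Rightarrow> 'v"
  where "sequent_val u dia \<rho> \<Gamma> = (\<Sum>(r, A)\<in>#\<Gamma>. real_of_preal r *\<^sub>R term_val u dia \<rho> A)"

definition hypersequent_val ::
    "'v::riesz_space \<Rightarrow> ('v \<Rightarrow> 'v) \<Rightarrow> (nat \<Rightarrow> 'v) \<Rightarrow> hypersequent \<Rightarrow> 'v"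
  where "hypersequent_val u dia \<rho> G = Sup_fin (sequent_val u dia \<rho> ` set_mset G)"

text \<open>Equational logic over the signature of modal Riesz spaces, in which scalar multiplication is one
  unary operation for each real number and \<open>-a\<close> is \<open>(-1)a\<close>.\<close>

datatype eterm =
    EVar nat
  | EZero
  | EOne
  | EPlus eterm eterm
  | EScale real eterm
  | EJoin eterm eterm
  | EMeet eterm eterm
  | EDia eterm

primrec subst :: "(nat \<Rightarrow> eterm) \<Rightarrow> eterm \<Rightarrow> eterm" where
  "subst \<sigma> (EVar x) = \<sigma> x"
| "subst \<sigma> EZero = EZero"
| "subst \<sigma> EOne = EOne"
| "subst \<sigma> (EPlus s t) = EPlus (subst \<sigma> s) (subst \<sigma> t)"
| "subst \<sigma> (EScale r s) = EScale r (subst \<sigma> s)"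
| "subst \<sigma> (EJoin s t) = EJoin (subst \<sigma> s) (subst \<sigma> t)"
| "subst \<sigma> (EMeet s t) = EMeet (subst \<sigma> s) (subst \<sigma> t)"
| "subst \<sigma> (EDia s) = EDia (subst \<sigma> s)"

type_synonym equation = "eterm \<times> eterm"

text \<open>The inequality \<open>s \<le> t\<close> is shorthand for the equation \<open>s \<sqinter> t = s\<close>.\<close>

definition leq :: "eterm \<Rightarrow> eterm \<Rightarrow> equation"
  where "leq s t = (EMeet s t, s)"

inductive equational :: "equation set \<Rightarrow> equation \<Rightarrow> bool" (infix \<open>\<turnstile>\<close> 50) for Ax where
  axiom: "e \<in> Ax \<Longrightarrow> Ax \<turnstile> e"
| refl: "Ax \<turnstile> (s, s)"
| sym: "Ax \<turnstile> (s, t) \<Longrightarrow> Ax \<turnstile> (t, s)"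
| trans: "Ax \<turnstile> (s, t) \<Longrightarrow> Ax \<turnstile> (t, t') \<Longrightarrow> Ax \<turnstile> (s, t')"
| subst: "Ax \<turnstile> (s, t) \<Longrightarrow> Ax \<turnstile> (subst \<sigma> s, subst \<sigma> t)"
| cong_plus: "Ax \<turnstile> (s, t) \<Longrightarrow> Ax \<turnstile> (s', t') \<Longrightarrow> Ax \<turnstile> (EPlus s s', EPlus t t')"
| cong_scale: "Ax \<turnstile> (s, t) \<Longrightarrow> Ax \<turnstile> (EScale r s, EScale r t)"
| cong_join: "Ax \<turnstile> (s, t) \<Longrightarrow> Ax \<turnstile> (s', t') \<Longrightarrow> Ax \<turnstile> (EJoin s s', EJoin t t')"
| cong_meet: "Ax \<turnstile> (s, t) \<Longrightarrow> Ax \<turnstile> (s', t') \<Longrightarrow> Ax \<turnstile> (EMeet s s', EMeet t t')"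
| cong_dia: "Ax \<turnstile> (s, t) \<Longrightarrow> Ax \<turnstile> (EDia s, EDia t)"

abbreviation (input) "vx \<equiv> EVar 0"
abbreviation (input) "vy \<equiv> EVar 1"
abbreviation (input) "vz \<equiv> EVar 2"

inductive_set modal_riesz_axioms :: "equation set" where
  plus_assoc: "(EPlus vx (EPlus vy vz), EPlus (EPlus vx vy) vz) \<in> modal_riesz_axioms"
| plus_comm: "(EPlus vx vy, EPlus vy vx) \<in> modal_riesz_axioms"
| plus_zero: "(EPlus vx EZero, vx) \<in> modal_riesz_axioms"
| plus_neg: "(EPlus vx (EScale (-1) vx), EZero) \<in> modal_riesz_axioms"
| scale_plus: "(EScale r (EPlus vx vy), EPlus (EScale r vx) (EScale r vy)) \<in> modal_riesz_axioms"
| plus_scale: "(EScale (r + s) vx, EPlus (EScale r vx) (EScale s vx)) \<in> modal_riesz_axioms"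
| scale_scale: "(EScale r (EScale s vx), EScale (r * s) vx) \<in> modal_riesz_axioms"
| scale_one: "(EScale 1 vx, vx) \<in> modal_riesz_axioms"
| join_assoc: "(EJoin vx (EJoin vy vz), EJoin (EJoin vx vy) vz) \<in> modal_riesz_axioms"
| join_comm: "(EJoin vx vy, EJoin vy vx) \<in> modal_riesz_axioms"
| join_absorb: "(EJoin vx (EMeet vx vy), vx) \<in> modal_riesz_axioms"
| meet_assoc: "(EMeet vx (EMeet vy vz), EMeet (EMeet vx vy) vz) \<in> modal_riesz_axioms"
| meet_comm: "(EMeet vx vy, EMeet vy vx) \<in> modal_riesz_axioms"
| meet_absorb: "(EMeet vx (EJoin vx vy), vx) \<in> modal_riesz_axioms"
| plus_mono: "leq (EPlus (EMeet vx vy) vz) (EPlus vy vz) \<in> modal_riesz_axioms"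
| scale_mono: "0 \<le> r \<Longrightarrow> leq (EScale r (EMeet vx vy)) (EScale r vy) \<in> modal_riesz_axioms"
| zero_le_one: "leq EZero EOne \<in> modal_riesz_axioms"
| dia_linear: "(EDia (EPlus (EScale r1 vx) (EScale r2 vy)),
      EPlus (EScale r1 (EDia vx)) (EScale r2 (EDia vy))) \<in> modal_riesz_axioms"
| dia_positive: "leq EZero (EDia (EJoin EZero vx)) \<in> modal_riesz_axioms"
| dia_one: "leq (EDia EOne) EOne \<in> modal_riesz_axioms"

text \<open>The interpretation of sequents and hypersequents as terms of the signature. As a syntactic term
  it depends on an enumeration of the multisets; a list of lists \<open>H\<close> enumerates the hypersequent
  \<open>mset (map mset H)\<close>. The join of no sequents is left unspecified.\<close>

primrec eterm_of :: "nterm \<Rightarrow> eterm" where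
  "eterm_of (Var x) = EVar x"
| "eterm_of (NVar x) = EScale (-1) (EVar x)"
| "eterm_of Zero = EZero"
| "eterm_of One = EOne"
| "eterm_of NOne = EScale (-1) EOne"
| "eterm_of (Plus A B) = EPlus (eterm_of A) (eterm_of B)"
| "eterm_of (Scale r A) = EScale (real_of_preal r) (eterm_of A)"
| "eterm_of (Join A B) = EJoin (eterm_of A) (eterm_of B)"
| "eterm_of (Meet A B) = EMeet (eterm_of A) (eterm_of B)"
| "eterm_of (Dia A) = EDia (eterm_of A)"

fun sequent_eterm :: "(preal \<times> nterm) list \<Rightarrow> eterm" where
  "sequent_eterm [] = EZero"
| "sequent_eterm ((r, A) # \<Gamma>) = EPlus (EScale (real_of_preal r) (eterm_of A)) (sequent_eterm \<Gamma>)"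

fun hypersequent_eterm :: "(preal \<times> nterm) list list \<Rightarrow> eterm" where
  "hypersequent_eterm [\<Gamma>] = sequent_eterm \<Gamma>"
| "hypersequent_eterm (\<Gamma> # \<Delta> # H) = EJoin (sequent_eterm \<Gamma>) (hypersequent_eterm (\<Delta> # H))"

end

theory Submission
  imports Defs "HOL-Library.Lattice_Algebras"
begin

text \<open>A hypersequent \<open>\<Gamma>\<^sub>1 | \<dots> | \<Gamma>\<^sub>n\<close> has nonnegative join iff the meet of the negative parts of the values
  of the \<open>\<Gamma>\<^sub>i\<close> is \<open>0\<close>. In this form every rule of the calculus is sound for elementary reasons, the only
  nontrivial one being M, which uses \<open>t \<sqinter> (x + y) \<le> t \<sqinter> x + t \<sqinter> y\<close> for nonnegative elements. The
  statement about equational logic is soundness in the free modal Riesz space, that is, the terms modulo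
  provable equality.\<close>

subsection \<open>Soundness in modal Riesz spaces\<close>

text \<open>With \<open>s = sup x y\<close>, the elements \<open>x - s\<close> and
  \<open>y - s\<close> have join 0. Translations preserve joins, so \<open>inf t s\<close> is the
  join of its translates by these two elements, and each translate lies below one of the meets on
  the right.\<close>

lemma (in lattice_ab_group_add) inf_sup_distrib_group: "inf t (sup x y) = sup (inf t x) (inf t y)"
proof (rule order.antisym)
  let ?s = "sup x y" and ?m = "sup (inf t x) (inf t y)"
  have *: "inf t ?s + (z - ?s) \<le> ?m" if "z = x \<or> z = y" for z
  proof -
    have "inf t ?s + (z - ?s) \<le> t + 0"
      by (rule add_mono, simp, subst le_iff_diff_le_0[symmetric]) (use that in auto)
    moreover have "inf t ?s + (z - ?s) \<le> ?s + (z - ?s)"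
      by (rule add_right_mono) simp
    then have "inf t ?s + (z - ?s) \<le> z"
      by (simp only: add_diff_cancel_left' add_diff_eq)
    ultimately have "inf t ?s + (z - ?s) \<le> inf t z"
      by (simp only: add_0_right le_inf_iff)
    also have "\<dots> \<le> ?m" using that by auto
    finally show ?thesis .
  qed
  have "inf t ?s = (inf t ?s - ?s) + ?s"
    by (simp only: diff_add_cancel)
  also have "\<dots> = sup (inf t ?s + (x - ?s)) (inf t ?s + (y - ?s))"
    by (simp only: add_sup_distrib_left) (simp add: algebra_simps)
  also have "\<dots> \<le> ?m" using * by simp
  finally show "inf t ?s \<le> ?m" .
qed (simp add: le_infI2)

subclass (in lattice_ab_group_add) distrib_lattice
  by standard (rule distrib_imp1, rule inf_sup_distrib_group)

subclass (in riesz_space) lattice_ab_group_add ..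

text \<open>The right-hand side expands to the meet of four sums. Positivity puts \<open>t\<close>
  below the three that contain it, and the fourth is \<open>x + y\<close>.\<close>

lemma (in lattice_ab_group_add) inf_add_le:
  assumes "0 \<le> t" "0 \<le> x" "0 \<le> y"
  shows "inf t (x + y) \<le> inf t x + inf t y"
proof -
  have "inf t x + inf t y = inf (inf (t + t) (x + t)) (inf (t + y) (x + y))"
    by (simp add: add_sup_inf_distribs)
  moreover have "t \<le> t + t" "t \<le> x + t" "t \<le> t + y"
    using assms by simp_all
  ultimately show ?thesis
    by (simp add: le_infI1)
qed

text \<open>For \<open>r > 0\<close> scaling is an order isomorphism, with inverse the scaling by
  \<open>inverse r\<close>.\<close>

lemma scaleR_inf_distrib:
  fixes a b :: "'v::riesz_space"
  assumes "0 \<le> r"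
  shows "r *\<^sub>R inf a b = inf (r *\<^sub>R a) (r *\<^sub>R b)"
proof (cases "r = 0")
  case False
  with assms have r: "0 < r" by simp
  show ?thesis
  proof (rule order.antisym)
    have "inverse r *\<^sub>R inf (r *\<^sub>R a) (r *\<^sub>R b) \<le> inverse r *\<^sub>R r *\<^sub>R a"
      "inverse r *\<^sub>R inf (r *\<^sub>R a) (r *\<^sub>R b) \<le> inverse r *\<^sub>R r *\<^sub>R b"
      using r by (auto intro!: scaleR_left_mono simp del: scaleR_scaleR)
    with r have "inverse r *\<^sub>R inf (r *\<^sub>R a) (r *\<^sub>R b) \<le> inf a b" by simp
    then have "r *\<^sub>R inverse r *\<^sub>R inf (r *\<^sub>R a) (r *\<^sub>R b) \<le> r *\<^sub>R inf a b"
      using r by (auto intro!: scaleR_left_mono simp del: scaleR_scaleR)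
    with r show "inf (r *\<^sub>R a) (r *\<^sub>R b) \<le> r *\<^sub>R inf a b" by simp
  qed (use assms in \<open>simp add: scaleR_left_mono\<close>)
qed simp

lemma pprt_scaleR:
  fixes a :: "'v::riesz_space"
  shows "0 \<le> r \<Longrightarrow> pprt (r *\<^sub>R a) = r *\<^sub>R pprt a"
  using arg_cong[OF scaleR_inf_distrib[of r "- a" 0], of uminus]
  by (simp add: pprt_def flip: scaleR_minus_right)

text \<open>\<open>pprt (- v)\<close> is the negative part of \<open>v\<close>. That the meet is 0
  is expressed through lower bounds, so multiplicities do not matter and no finite meet has to be
  formed.\<close>

definition disjoint_nprts :: "'v::riesz_space multiset \<Rightarrow> bool"
  where "disjoint_nprts V \<longleftrightarrow> (\<forall>t. (\<forall>v\<in>#V. t \<le> pprt (- v)) \<longrightarrow> t \<le> 0)"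

text \<open>All negative parts are nonnegative, so a common lower bound \<open>t\<close> may be
  replaced by \<open>pprt t\<close>.\<close>

lemma disjoint_nprtsI:
  assumes "\<And>t. 0 \<le> t \<Longrightarrow> \<forall>v\<in>#V. t \<le> pprt (- v) \<Longrightarrow> t \<le> 0"
  shows "disjoint_nprts V"
  unfolding disjoint_nprts_def
proof (intro allI impI)
  fix t
  assume "\<forall>v\<in>#V. t \<le> pprt (- v)"
  then have "pprt t \<le> 0"
    by (intro assms) (auto simp: pprt_def)
  then show "t \<le> 0" by (simp add: pprt_def)
qed

lemma disjoint_nprtsD: "disjoint_nprts V \<Longrightarrow> \<forall>v\<in>#V. t \<le> pprt (- v) \<Longrightarrow> t \<le> 0"
  by (simp add: disjoint_nprts_def)

lemma disjoint_nprts_single: "disjoint_nprts {#v#} \<longleftrightarrow> 0 \<le> v"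
proof
  assume "disjoint_nprts {#v#}"
  then have "pprt (- v) \<le> 0" by (rule disjoint_nprtsD) simp
  then show "0 \<le> v" by (simp add: pprt_def)
qed (simp add: disjoint_nprts_def)

text \<open>Every member is below the join, so the negative part of the join is a common lower bound
  of the negative parts.\<close>

lemma Sup_fin_nonneg:
  assumes "V \<noteq> {#}" "disjoint_nprts V"
  shows "0 \<le> Sup_fin (set_mset V)"
proof -
  let ?s = "Sup_fin (set_mset V)"
  have "pprt (- ?s) \<le> 0"
    using assms(2) by (rule disjoint_nprtsD) (simp add: Sup_fin.coboundedI)
  then show ?thesis by (simp add: pprt_def)
qed

section \<open>Closure properties behind the rules\<close>

lemma disjoint_nprts_weaken: "disjoint_nprts V \<Longrightarrow> disjoint_nprts (add_mset a V)"
  by (simp add: disjoint_nprts_def)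

text \<open>By distributivity \<open>t\<close> is below the positive part of
  \<open>m = inf (- a) (- b)\<close>. Doubling leads to the sum, because \<open>m + m\<close> is
  below \<open>- (a + b)\<close>.\<close>

lemma disjoint_nprts_split:
  assumes "disjoint_nprts (V + {#a + b#})"
  shows "disjoint_nprts (V + {#a#} + {#b#})"
proof (rule disjoint_nprtsI)
  fix t :: 'a
  assume t: "0 \<le> t" "\<forall>v\<in>#V + {#a#} + {#b#}. t \<le> pprt (- v)"
  let ?m = "inf (- a) (- b)"
  have "t \<le> pprt ?m"
    using t by (simp add: pprt_def sup_inf_distrib2)
  also have "\<dots> \<le> 2 *\<^sub>R pprt ?m"
    by (simp add: scaleR_2)
  also have "\<dots> = pprt (2 *\<^sub>R ?m)"
    by (simp add: pprt_scaleR)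
  also have "\<dots> \<le> pprt (- (a + b))"
    using add_mono[of ?m "- a" ?m "- b"] by (intro pprt_mono) (simp add: scaleR_2)
  finally show "t \<le> 0"
    using t by (intro disjoint_nprtsD[OF assms]) simp
qed

text \<open>The negative part of a sum is at most the sum of the negative parts. Meeting with
  \<open>t\<close> splits this bound by \<open>inf_add_le\<close> into two meets, each a lower bound
  for one hypothesis.\<close>

lemma disjoint_nprts_add:
  assumes "disjoint_nprts (V + {#a#})" "disjoint_nprts (V + {#b#})"
  shows "disjoint_nprts (V + {#a + b#})"
proof (rule disjoint_nprtsI)
  fix t :: 'a
  assume t: "0 \<le> t" "\<forall>v\<in>#V + {#a + b#}. t \<le> pprt (- v)"
  let ?a = "pprt (- a)" and ?b = "pprt (- b)"
  have "- (a + b) \<le> ?a + ?b"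
    using add_mono[of "- a" ?a "- b" ?b] by (simp add: pprt_def)
  then have "pprt (- (a + b)) \<le> ?a + ?b"
    unfolding pprt_def[of "- (a + b)"] by simp
  with t have "t \<le> ?a + ?b" by force
  with t(1) have "t \<le> inf t ?a + inf t ?b"
    using inf_add_le[of t ?a ?b] by (simp add: inf_absorb1)
  also have "\<dots> \<le> 0 + 0"
    using t(2) by (intro add_mono disjoint_nprtsD[OF assms(1)] disjoint_nprtsD[OF assms(2)])
      (auto intro: le_infI1)
  finally show "t \<le> 0" by simp
qed

lemma disjoint_nprts_scaleR:
  assumes "0 < r" "disjoint_nprts (V + {#r *\<^sub>R a#})"
  shows "disjoint_nprts (V + {#a#})"
proof (rule disjoint_nprtsI)
  fix t :: 'a
  assume t: "0 \<le> t" "\<forall>v\<in>#V + {#a#}. t \<le> pprt (- v)"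
  \<comment> \<open>The factor is at most 1 to stay below the negative parts from \<open>V\<close>,
    at most \<open>r\<close> to get below that of \<open>r *\<^sub>R a\<close>, and positive so that
    it can be cancelled at the end.\<close>
  let ?q = "min r 1"
  have "?q *\<^sub>R t \<le> 0"
  proof (rule disjoint_nprtsD[OF assms(2)], intro ballI)
    fix v
    assume "v \<in># V + {#r *\<^sub>R a#}"
    moreover have "?q *\<^sub>R t \<le> 1 *\<^sub>R t"
      using t(1) by (intro scaleR_right_mono) auto
    then have "?q *\<^sub>R t \<le> pprt (- v)" if "v \<in># V"
      using t(2) that by (auto intro: order_trans)
    moreover have "?q *\<^sub>R t \<le> r *\<^sub>R pprt (- a)"
      using assms(1) t by (intro order_trans[OF scaleR_right_mono[of ?q r t]] scaleR_left_mono) auto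
    then have "?q *\<^sub>R t \<le> pprt (- (r *\<^sub>R a))"
      using assms(1) pprt_scaleR[of r "- a"] by simp
    ultimately show "?q *\<^sub>R t \<le> pprt (- v)" by auto
  qed
  then have "inverse ?q *\<^sub>R ?q *\<^sub>R t \<le> inverse ?q *\<^sub>R 0"
    using assms(1) by (intro scaleR_left_mono) auto
  then show "t \<le> 0" using assms(1) by simp
qed

lemma disjoint_nprts_mono:
  assumes "disjoint_nprts (V + {#a#})" "a \<le> b"
  shows "disjoint_nprts (V + {#b#})"
proof (rule disjoint_nprtsI)
  fix t :: 'a
  assume t: "0 \<le> t" "\<forall>v\<in>#V + {#b#}. t \<le> pprt (- v)"
  moreover have "pprt (- b) \<le> pprt (- a)"
    using assms(2) by simp
  ultimately show "t \<le> 0"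
    by (intro disjoint_nprtsD[OF assms(1)]) (auto intro: order_trans)
qed

text \<open>Raising \<open>a\<close> and \<open>b\<close> to the common bound \<open>c\<close>
  leaves two copies of \<open>c\<close>, which count once. The case \<open>a = b = c\<close> is
  contraction.\<close>

lemma disjoint_nprts_sup:
  assumes "disjoint_nprts (V + {#a#} + {#b#})" "a \<le> c" "b \<le> c"
  shows "disjoint_nprts (V + {#c#})"
proof -
  have "disjoint_nprts (V + {#a#} + {#c#})"
    using assms disjoint_nprts_mono[of "V + {#a#}"] by blast
  then have "disjoint_nprts (V + {#c#} + {#c#})"
    using assms(2) disjoint_nprts_mono[of "V + {#c#}" a] by (simp add: add_mset_commute)
  then show ?thesis
    by - (rule disjoint_nprtsI, erule disjoint_nprtsD, simp)
qed

text \<open>Taking negative parts turns the meet into a join, over which \<open>inf t\<close>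
  distributes.\<close>

lemma disjoint_nprts_inf:
  assumes "disjoint_nprts (V + {#a#})" "disjoint_nprts (V + {#b#})"
  shows "disjoint_nprts (V + {#inf a b#})"
proof (rule disjoint_nprtsI)
  fix t :: 'a
  assume t: "0 \<le> t" "\<forall>v\<in>#V + {#inf a b#}. t \<le> pprt (- v)"
  let ?a = "pprt (- a)" and ?b = "pprt (- b)"
  have "pprt (- inf a b) = sup ?a ?b"
    by (simp add: pprt_def neg_inf_eq_sup sup_aci)
  with t have "t = sup (inf t ?a) (inf t ?b)"
    by (simp add: inf_absorb1 flip: inf_sup_distrib1)
  also have "\<dots> \<le> 0"
    using t(2) by (intro le_supI disjoint_nprtsD[OF assms(1)] disjoint_nprtsD[OF assms(2)])
      (auto intro: le_infI1)
  finally show "t \<le> 0" .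
qed

section \<open>Values of weights and sequents\<close>

lemma real_of_preal_pos [simp]: "0 < real_of_preal r"
  using real_of_preal[of r] by simp

lemma real_of_preal_mult [simp]: "real_of_preal (r *\<^sub>p s) = real_of_preal r * real_of_preal s"
  by (simp add: preal_mult_def Abs_preal_inverse)

lemma total_nonneg [simp]: "0 \<le> total rs"
  by (induction rs) (simp_all add: total_def add_nonneg_nonneg less_imp_le)

lemma total_map_mult [simp]: "total (map (\<lambda>r. s *\<^sub>p r) rs) = real_of_preal s * total rs"
  by (induction rs) (simp_all add: total_def distrib_left)

lemma sequent_val_empty [simp]: "sequent_val u dia \<rho> {#} = 0"
  by (simp add: sequent_val_def)

lemma sequent_val_add [simp]:
  "sequent_val u dia \<rho> (\<Gamma> + \<Delta>) = sequent_val u dia \<rho> \<Gamma> + sequent_val u dia \<rho> \<Delta>"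
  by (simp add: sequent_val_def)

lemma sequent_val_add_mset [simp]:
  "sequent_val u dia \<rho> (add_mset (r, A) \<Gamma>) =
    real_of_preal r *\<^sub>R term_val u dia \<rho> A + sequent_val u dia \<rho> \<Gamma>"
  by (simp add: sequent_val_def)

lemma sequent_val_weighted [simp]:
  "sequent_val u dia \<rho> (rs \<^bold>. A) = total rs *\<^sub>R term_val u dia \<rho> A"
  by (induction rs) (simp_all add: weighted_def total_def scaleR_left_distrib)

lemma sequent_val_scale [simp]:
  "sequent_val u dia \<rho> (scale_sequent s \<Gamma>) = real_of_preal s *\<^sub>R sequent_val u dia \<rho> \<Gamma>"
  by (induction \<Gamma>) (auto simp: scale_sequent_def scaleR_right_distrib)

context modal_riesz_space
begin

lemma dia_scaleR: "dia (r *\<^sub>R a) = r *\<^sub>R dia a"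
  using dia_linear[of r a 0 0] by simp

lemma dia_add: "dia (a + b) = dia a + dia b"
  using dia_linear[of 1 a 1 b] by simp

lemma dia_zero: "dia 0 = 0"
  using dia_scaleR[of 0 0] by simp

lemma dia_minus: "dia (- a) = - dia a"
  using dia_scaleR[of "- 1" a] by simp

lemma dia_nonneg: "0 \<le> a \<Longrightarrow> 0 \<le> dia a"
  using dia_positive[of a] by (simp add: sup_absorb2)

lemma term_val_neg: "term_val u dia \<rho> (neg A) = - term_val u dia \<rho> A"
  by (induction A) (simp_all add: neg_inf_eq_sup neg_sup_eq_inf dia_minus)

lemma sequent_val_dia: "sequent_val u dia \<rho> (dia_sequent \<Gamma>) = dia (sequent_val u dia \<rho> \<Gamma>)"
  by (induction \<Gamma>) (auto simp: dia_sequent_def dia_add dia_scaleR dia_zero)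

text \<open>\<open>ID\<close>, \<open>ZERO\<close>, \<open>PLUS\<close>, \<open>TIMES\<close> and
  \<open>CAN\<close> keep the value of the active sequent; \<open>W\<close>, \<open>C\<close>,
  \<open>S\<close>, \<open>M\<close>, \<open>T\<close>, \<open>JOIN\<close>, \<open>MEET\<close> and
  \<open>ONE\<close> each use one closure property.\<close>

lemma HMR_disjoint_nprts:
  "HMR G \<Longrightarrow> disjoint_nprts (image_mset (sequent_val u dia \<rho>) G)"
proof (induction rule: HMR.induct)
  let ?v = "sequent_val u dia \<rho>"
  let ?V = "image_mset ?v"
  {
    case INIT
    then show ?case by (simp add: disjoint_nprts_single)
  next
    case (W G \<Gamma>)
    then show ?case by (simp add: disjoint_nprts_weaken)
  next
    case (C G \<Gamma>)
    then show ?case using disjoint_nprts_sup[of "?V G" "?v \<Gamma>" "?v \<Gamma>"] by simp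
  next
    case (S G \<Gamma>1 \<Gamma>2)
    then show ?case using disjoint_nprts_split[of "?V G" "?v \<Gamma>1" "?v \<Gamma>2"] by simp
  next
    case (M G \<Gamma>1 \<Gamma>2)
    then show ?case using disjoint_nprts_add[of "?V G" "?v \<Gamma>1" "?v \<Gamma>2"] by simp
  next
    case (T G r \<Gamma>)
    then show ?case using disjoint_nprts_scaleR[of "real_of_preal r" "?V G" "?v \<Gamma>"] by simp
  next
    case (ID rs ss G \<Gamma> x)
    then show ?case by simp
  next
    case (ZERO G \<Gamma> rs)
    then show ?case by simp
  next
    case (PLUS G \<Gamma> rs A B)
    then show ?case by (simp add: algebra_simps)
  next
    case (TIMES G \<Gamma> s rs A)
    then show ?case by (simp add: mult.commute)
  next
    case (JOIN G \<Gamma> rs A B)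
    then show ?case
      \<comment> \<open>Both premise sequents have values below that of the conclusion, so an upper
        bound suffices and scaling is not distributed over the join.\<close>
      using disjoint_nprts_sup[of "?V G" "?v (\<Gamma> + rs \<^bold>. A)" "?v (\<Gamma> + rs \<^bold>. B)"
          "?v (\<Gamma> + rs \<^bold>. Join A B)"]
      by (simp add: scaleR_left_mono)
  next
    case (MEET G \<Gamma> rs A B)
    then show ?case
      using disjoint_nprts_inf[of "?V G" "?v (\<Gamma> + rs \<^bold>. A)" "?v (\<Gamma> + rs \<^bold>. B)"]
      by (simp add: scaleR_inf_distrib add_inf_distrib_left)
  next
    case (CAN rs ss G \<Gamma> A)
    then show ?case by (simp add: term_val_neg)
  next
    case (ONE rs ss G \<Gamma>)
    have "total ss *\<^sub>R u \<le> total rs *\<^sub>R u"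
      using ONE zero_le_unit by (intro scaleR_right_mono)
    with ONE show ?case
      using disjoint_nprts_mono[of "?V G" "?v \<Gamma>" "?v (\<Gamma> + rs \<^bold>. One + ss \<^bold>. NOne)"]
      by simp
  next
    case (DIA rs ss \<Gamma>)
    let ?g = "?v \<Gamma>" and ?d = "total rs - total ss"
    \<comment> \<open>For a single sequent disjointness is plain nonnegativity, which
      \<open>dia\<close> preserves. The side condition makes \<open>?d\<close> nonnegative, so
      \<open>dia_unit\<close> can be scaled by it.\<close>
    have "0 \<le> dia (?g + ?d *\<^sub>R u)"
      using DIA by (intro dia_nonneg) (simp add: disjoint_nprts_single algebra_simps)
    also have "\<dots> = dia ?g + ?d *\<^sub>R dia u"
      by (simp add: dia_add dia_scaleR)
    also have "\<dots> \<le> dia ?g + ?d *\<^sub>R u"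
      using DIA(1) dia_unit by (intro add_left_mono scaleR_left_mono) auto
    finally show ?case
      by (simp add: disjoint_nprts_single sequent_val_dia algebra_simps)
  }
qed

lemma HMR_sound:
  assumes "HMR G"
  shows "0 \<le> hypersequent_val u dia \<rho> G"
  using Sup_fin_nonneg[OF _ HMR_disjoint_nprts[OF assms]] HMR_nonempty[OF assms]
  by (simp add: hypersequent_val_def)

end

subsection \<open>The free modal Riesz space\<close>

\<comment> \<open>The Lindenbaum algebra of the axioms: provable equality is an equivalence, and the
  congruence rules let the operations descend to classes.\<close>
quotient_type free_mrs = eterm / "\<lambda>s t. modal_riesz_axioms \<turnstile> (s, t)"
  by (auto intro!: equivpI reflpI sympI transpI intro: equational.refl equational.sym equational.trans)

instantiation free_mrs :: "{zero, one, plus, minus, uminus, scaleR, sup, inf, ord}"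
begin

lift_definition zero_free_mrs :: free_mrs is EZero .
lift_definition one_free_mrs :: free_mrs is EOne .
lift_definition plus_free_mrs :: "free_mrs \<Rightarrow> free_mrs \<Rightarrow> free_mrs" is EPlus
  by (rule equational.cong_plus)
lift_definition scaleR_free_mrs :: "real \<Rightarrow> free_mrs \<Rightarrow> free_mrs" is EScale
  by (rule equational.cong_scale)
lift_definition sup_free_mrs :: "free_mrs \<Rightarrow> free_mrs \<Rightarrow> free_mrs" is EJoin
  by (rule equational.cong_join)
lift_definition inf_free_mrs :: "free_mrs \<Rightarrow> free_mrs \<Rightarrow> free_mrs" is EMeet
  by (rule equational.cong_meet)
lift_definition uminus_free_mrs :: "free_mrs \<Rightarrow> free_mrs" is "EScale (- 1)"
  by (rule equational.cong_scale)
lift_definition minus_free_mrs :: "free_mrs \<Rightarrow> free_mrs \<Rightarrow> free_mrs" is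
    "\<lambda>s t. EPlus s (EScale (- 1) t)"
  by (intro equational.cong_plus equational.cong_scale)
text \<open>Mirrors \<open>leq\<close>, so that order between classes is provability of the
  inequality.\<close>

definition less_eq_free_mrs :: "free_mrs \<Rightarrow> free_mrs \<Rightarrow> bool" where
  "less_eq_free_mrs a b \<longleftrightarrow> inf a b = a"
definition less_free_mrs :: "free_mrs \<Rightarrow> free_mrs \<Rightarrow> bool" where
  "less_free_mrs a b \<longleftrightarrow> a \<le> b \<and> \<not> b \<le> a"

instance ..

end

lift_definition free_dia :: "free_mrs \<Rightarrow> free_mrs" is EDia
  by (rule equational.cong_dia)

text \<open>Only the variables 0, 1 and 2 occur in the axioms, so the unspecified values of
  \<open>[a, b, c] ! n\<close> for larger \<open>n\<close> never enter.\<close>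

lemma free_mrs_axiom:
  assumes "(s, t) \<in> modal_riesz_axioms"
  shows "modal_riesz_axioms \<turnstile> (subst (\<lambda>n. [a, b, c] ! n) s, subst (\<lambda>n. [a, b, c] ! n) t)"
  using assms by (intro equational.subst equational.axiom)

context
  notes ax = modal_riesz_axioms.intros[unfolded leq_def, THEN free_mrs_axiom, simplified]
begin

text \<open>The equations follow the order of the axioms and are cited by position. Inequalities
  appear as meet equations, matching \<open>less_eq_free_mrs\<close>.\<close>

lemma free_mrs_equations:
  fixes a b c :: free_mrs
  shows "a + (b + c) = (a + b) + c"
    and "a + b = b + a"
    and "a + 0 = a"
    and "a + - a = 0"
    and "r *\<^sub>R (a + b) = r *\<^sub>R a + r *\<^sub>R b"
    and "(r + s) *\<^sub>R a = r *\<^sub>R a + s *\<^sub>R a"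
    and "r *\<^sub>R s *\<^sub>R a = (r * s) *\<^sub>R a"
    and "1 *\<^sub>R a = a"
    and "sup a (sup b c) = sup (sup a b) c"
    and "sup a b = sup b a"
    and "sup a (inf a b) = a"
    and "inf a (inf b c) = inf (inf a b) c"
    and "inf a b = inf b a"
    and "inf a (sup a b) = a"
    and "inf (inf a b + c) (b + c) = inf a b + c"
    and "0 \<le> r \<Longrightarrow> inf (r *\<^sub>R inf a b) (r *\<^sub>R b) = r *\<^sub>R inf a b"
    and "inf 0 (1::free_mrs) = 0"
    and "free_dia (r *\<^sub>R a + s *\<^sub>R b) = r *\<^sub>R free_dia a + s *\<^sub>R free_dia b"
    and "inf 0 (free_dia (sup 0 a)) = 0"
    and "inf (free_dia 1) 1 = free_dia 1"
  by (transfer, rule ax, assumption?)+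

end

lemma minus_free_mrs_eq: "a - b = a + - b" for a b :: free_mrs
  by (transfer, rule equational.refl)

text \<open>If \<open>a \<le> b\<close>, the meet \<open>inf a b\<close> in the equational axiom
  collapses to \<open>a\<close>.\<close>

lemma free_mrs_add_mono:
  fixes a b c :: free_mrs
  shows "a \<le> b \<Longrightarrow> a + c \<le> b + c"
  using free_mrs_equations(15)[of a b c] by (simp add: less_eq_free_mrs_def)

instance free_mrs :: riesz_space
proof
  fix a b c :: free_mrs and r s :: real
  note defs = less_eq_free_mrs_def less_free_mrs_def
  note add_assoc = free_mrs_equations(1) and add_commute = free_mrs_equations(2)
    and add_zero = free_mrs_equations(3) and add_neg = free_mrs_equations(4)
  note sup_assoc = free_mrs_equations(9) and sup_commute = free_mrs_equations(10)
    and sup_absorb = free_mrs_equations(11)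
  note inf_assoc = free_mrs_equations(12) and inf_commute = free_mrs_equations(13)
    and inf_absorb = free_mrs_equations(14)
  show "a + b + c = a + (b + c)" by (rule add_assoc[symmetric])
  show "a + b = b + a" by (rule add_commute)
  show "0 + a = a" by (metis add_commute add_zero)
  show "- a + a = 0" by (metis add_commute add_neg)
  show "a - b = a + - b" by (rule minus_free_mrs_eq)
  show "r *\<^sub>R (a + b) = r *\<^sub>R a + r *\<^sub>R b" by (rule free_mrs_equations)
  show "(r + s) *\<^sub>R a = r *\<^sub>R a + s *\<^sub>R a" by (rule free_mrs_equations)
  show "r *\<^sub>R s *\<^sub>R a = (r * s) *\<^sub>R a" by (rule free_mrs_equations)
  show "1 *\<^sub>R a = a" by (rule free_mrs_equations)
  show "a < b \<longleftrightarrow> a \<le> b \<and> \<not> b \<le> a" by (rule less_free_mrs_def)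
  show "a \<le> a" unfolding defs by (metis inf_absorb sup_absorb)
  show "a \<le> c" if "a \<le> b" "b \<le> c" using that unfolding defs by (metis inf_assoc)
  show "a = b" if "a \<le> b" "b \<le> a" using that unfolding defs by (metis inf_commute)
  \<comment> \<open>By absorption \<open>sup a (inf a a)\<close> is \<open>a\<close>, and meeting it
    with \<open>a\<close> gives \<open>a\<close> again.\<close>
  have idem: "inf a a = a" for a :: free_mrs by (metis inf_absorb sup_absorb)
  show "inf a b \<le> a" unfolding defs by (metis inf_assoc inf_commute idem)
  show "inf a b \<le> b" unfolding defs by (metis inf_assoc idem)
  show "a \<le> inf b c" if "a \<le> b" "a \<le> c" using that unfolding defs by (metis inf_assoc)
  \<comment> \<open>Expressing the order by joins reduces the least upper bound property to
    associativity.\<close>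
  have le_sup: "a \<le> b \<longleftrightarrow> sup a b = b" for a b :: free_mrs
    unfolding defs by (metis inf_absorb inf_commute sup_absorb sup_commute)
  show "a \<le> sup a b" unfolding defs by (rule inf_absorb)
  show "b \<le> sup a b" unfolding defs by (metis inf_absorb sup_commute)
  show "sup b c \<le> a" if "b \<le> a" "c \<le> a" using that unfolding le_sup by (metis sup_assoc)
  show "c + a \<le> c + b" if "a \<le> b"
    using free_mrs_add_mono[OF that] by (metis add_commute)
  show "r *\<^sub>R a \<le> r *\<^sub>R b" if "a \<le> b" "0 \<le> r"
    using that free_mrs_equations(16)[of r a b] by (simp add: defs)
  show "r *\<^sub>R a \<le> s *\<^sub>R a" if "r \<le> s" "0 \<le> a"
  proof -
    \<comment> \<open>The scalar \<open>s\<close> is split as \<open>(s - r) + r\<close>; the first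
      summand contributes a nonnegative element, since scaling by a nonnegative factor is monotone
      and fixes 0.\<close>
    have pos: "t *\<^sub>R 0 \<le> t *\<^sub>R a" if "0 \<le> t" for t
      using that \<open>0 \<le> a\<close> free_mrs_equations(16)[of t 0 a] by (simp add: defs)
    have zero: "t *\<^sub>R 0 = (0 :: free_mrs)" for t
      by (metis add_assoc add_neg add_zero free_mrs_equations(5))
    have "0 + r *\<^sub>R a \<le> (s - r) *\<^sub>R a + r *\<^sub>R a"
      using pos[of "s - r"] \<open>r \<le> s\<close> unfolding zero by (intro free_mrs_add_mono) simp
    also have "(s - r) *\<^sub>R a + r *\<^sub>R a = s *\<^sub>R a"
      by (simp flip: free_mrs_equations(6))
    finally show ?thesis
      by (metis add_commute add_zero)
  qed
qed

lemma modal_riesz_space_free: "modal_riesz_space (1 :: free_mrs) free_dia"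
  by unfold_locales
    (use free_mrs_equations(17-20) in \<open>simp_all only: less_eq_free_mrs_def\<close>)

section \<open>Evaluation at the generic assignment\<close>

lift_definition free_var :: "nat \<Rightarrow> free_mrs" is EVar .

text \<open>The truth lemma: evaluation in the free space amounts to forming the class of a term, so
  what holds there at this assignment is provable.\<close>

lemma term_val_free: "term_val 1 free_dia free_var A = abs_free_mrs (eterm_of A)"
  by (induction A) (simp_all add: free_var.abs_eq zero_free_mrs.abs_eq one_free_mrs.abs_eq
      plus_free_mrs.abs_eq scaleR_free_mrs.abs_eq uminus_free_mrs.abs_eq sup_free_mrs.abs_eq
      inf_free_mrs.abs_eq free_dia.abs_eq)

lemma sequent_val_free: "sequent_val 1 free_dia free_var (mset \<Gamma>) = abs_free_mrs (sequent_eterm \<Gamma>)"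
  by (induction \<Gamma> rule: sequent_eterm.induct)
    (simp_all add: sequent_val_def term_val_free zero_free_mrs.abs_eq plus_free_mrs.abs_eq
      scaleR_free_mrs.abs_eq)

text \<open>Idempotence of \<open>sup\<close> reconciles the join over the underlying set with the
  join over list entries. The empty list is excluded because \<open>hypersequent_eterm\<close> is
  unspecified there.\<close>

lemma hypersequent_val_free:
  "H \<noteq> [] \<Longrightarrow>
    hypersequent_val 1 free_dia free_var (mset (map mset H)) = abs_free_mrs (hypersequent_eterm H)"
  by (induction H rule: hypersequent_eterm.induct)
    (simp_all add: hypersequent_val_def sequent_val_free sup_free_mrs.abs_eq)

lemma abs_free_mrs_nonneg_iff: "0 \<le> abs_free_mrs t \<longleftrightarrow> modal_riesz_axioms \<turnstile> leq EZero t"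
  by (simp add: less_eq_free_mrs_def leq_def zero_free_mrs.abs_eq inf_free_mrs.abs_eq
      free_mrs.abs_eq_iff)

theorem theorem4p5:
  fixes G :: hypersequent
  assumes "HMR G"
  shows "(\<forall>H. mset (map mset H) = G \<longrightarrow> modal_riesz_axioms \<turnstile> leq EZero (hypersequent_eterm H)) \<and>
    (\<forall>(u::'v::riesz_space) dia \<rho>. modal_riesz_space u dia \<longrightarrow> 0 \<le> hypersequent_val u dia \<rho> G)"
proof (intro conjI allI impI)
  fix H
  assume H: "mset (map mset H) = G"
  have "0 \<le> hypersequent_val 1 free_dia free_var G"
    using assms by (rule modal_riesz_space.HMR_sound[OF modal_riesz_space_free])
  \<comment> \<open>Derivable hypersequents are nonempty, which rules out the unspecified empty
    join.\<close>
  moreover have "H \<noteq> []"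
    using H HMR_nonempty[OF assms] by auto
  ultimately show "modal_riesz_axioms \<turnstile> leq EZero (hypersequent_eterm H)"
    by (metis H hypersequent_val_free abs_free_mrs_nonneg_iff)
next
  fix u :: 'v and dia \<rho>
  assume "modal_riesz_space u dia"
  then show "0 \<le> hypersequent_val u dia \<rho> G"
    using assms by (rule modal_riesz_space.HMR_sound)
qed

end
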